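(* Let $n\ge 4$, $r=\lfloor\log_2 n\rfloor$ and $k\in\{1,\dots,n\}$. Let $\mathbf L=(\ell_{i,j})\in\mathbb F_2^{(n-k)\times k}$ and, for $i=1,\dots,n-k$, let $\ell_i=\sum_{j=1}^k\ell_{i,j}x_j\in R_k=\mathbb F_2[x_1,\dots,x_k]$. Let $Q_k=(x_1^2,\dots,x_k^2)\subseteq R_k$ and $$J_k'=\big(e_{k,2^i}(x_1,\dots,x_k)+e_{n-k,2^i}(\ell_1,\dots,\ell_{n-k})\;\big|\; i=0,\dots,r-1\big)+Q_k\subseteq R_k .$$ Then the degree of regularity of $J_k'$ satisfies $$d_{\operatorname{reg}}(J_k')\le\begin{cases}\left\lfloor\frac{k+\operatorname{rk}(\mathbf L)}{2}\right\rfloor+2=2^r+1 & \text{if } n=2^{r+1}-1,\ k\ge 2^r \text{ and } \operatorname{rk}(\mathbf L)=n-k,\\[4pt] \left\lfloor\frac{k+\operatorname{rk}(\mathbf L)}{2}\right\rfloor+1 & \text{otherwise.}\end{cases}$$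
   Context: $e_{m,j}(y_1,\dots,y_m)=\sum_{\alpha\subseteq\{1,\dots,m\},\,|\alpha|=j}\prod_{a\in\alpha}y_a$ is the elementary symmetric polynomial of degree $j$ in $m$ arguments, with $e_{m,0}=1$ and $e_{m,j}=0$ for $j>m$. The ideal $J_k'$ is homogeneous. For a homogeneous ideal $J\subseteq R_k$, $d_{\operatorname{reg}}(J)=\min\{d\in\mathbb N\mid J\cap R_{k,d}=R_{k,d}\}$, where $R_{k,d}$ is the $\mathbb F_2$-vector space of homogeneous polynomials of degree $d$ in $R_k$. $\operatorname{rk}$ denotes matrix rank over $\mathbb F_2$ (an empty matrix has rank $0$). *)

theory Defs
  imports
    Complex_Main
    "HOL-Library.Poly_Mapping"
    "HOL-Library.Z2"
    "HOL-Algebra.Ideal"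
    "Jordan_Normal_Form.DL_Rank"
begin

text \<open>
  The field with two elements is the type \<^typ>\<open>bit\<close>. Polynomials over it are finitely supported
  maps from exponent vectors to coefficients, in variables indexed by \<^typ>\<open>nat\<close>. Indices start
  at 0, as matrix indices do: \<open>var j\<close> is the variable $x_{j+1}$, and \<^term>\<open>L $$ (i, j)\<close> is the
  entry $\ell_{i+1,j+1}$.
\<close>

type_synonym mpoly2 = "(nat \<Rightarrow>\<^sub>0 nat) \<Rightarrow>\<^sub>0 bit"

definition var :: "nat \<Rightarrow> mpoly2" where
  "var j = Poly_Mapping.single (Poly_Mapping.single j 1) 1"

definition const :: "bit \<Rightarrow> mpoly2" where
  "const c = Poly_Mapping.single 0 c"

definition R :: "nat \<Rightarrow> mpoly2 ring" where
  "R k = \<lparr> carrier = {p. \<forall>m \<in> Poly_Mapping.keys p. Poly_Mapping.keys m \<subseteq> {..<k}},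
           mult = (*), one = 1, zero = 0, add = (+) \<rparr>"

definition total_deg :: "(nat \<Rightarrow>\<^sub>0 nat) \<Rightarrow> nat" where
  "total_deg m = (\<Sum>v \<in> Poly_Mapping.keys m. Poly_Mapping.lookup m v)"

text \<open>The homogeneous component of degree \<open>d\<close>, which contains the zero polynomial.\<close>

definition homog :: "nat \<Rightarrow> nat \<Rightarrow> mpoly2 set" where
  "homog k d = {p \<in> carrier (R k). \<forall>m \<in> Poly_Mapping.keys p. total_deg m = d}"

definition elem_sym :: "nat \<Rightarrow> nat \<Rightarrow> (nat \<Rightarrow> 'a::comm_ring_1) \<Rightarrow> 'a" where
  "elem_sym m j y = (\<Sum>\<alpha> | \<alpha> \<subseteq> {..<m} \<and> card \<alpha> = j. \<Prod>a\<in>\<alpha>. y a)"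

definition lin_form :: "nat \<Rightarrow> bit mat \<Rightarrow> nat \<Rightarrow> mpoly2" where
  "lin_form k L i = (\<Sum>j<k. const (L $$ (i, j)) * var j)"

definition Q :: "nat \<Rightarrow> mpoly2 set" where
  "Q k = Idl\<^bsub>R k\<^esub> {var j ^ 2 | j. j < k}"

definition J' :: "nat \<Rightarrow> nat \<Rightarrow> nat \<Rightarrow> bit mat \<Rightarrow> mpoly2 set" where
  "J' n r k L =
     Idl\<^bsub>R k\<^esub> {elem_sym k (2 ^ i) var + elem_sym (n - k) (2 ^ i) (lin_form k L) | i. i < r}
     <+>\<^bsub>R k\<^esub> Q k"

text \<open>
  The minimum exists for \<open>J = J' n r k L\<close>: by pigeonhole, every monomial of degree greater
  than \<open>k\<close> in \<open>k\<close> variables is divisible by the square of a variable; see \<open>dreg_attained\<close> below.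
\<close>

definition dreg :: "nat \<Rightarrow> mpoly2 set \<Rightarrow> nat" where
  "dreg k J = (LEAST d. J \<inter> homog k d = homog k d)"

lemma R_simps [simp]:
  "mult (R k) = (*)" "one (R k) = 1" "zero (R k) = 0" "add (R k) = (+)"
  by (simp_all add: R_def)

lemma in_R: "p \<in> carrier (R k) \<longleftrightarrow> (\<forall>m \<in> Poly_Mapping.keys p. Poly_Mapping.keys m \<subseteq> {..<k})"
  by (simp add: R_def)

lemma R_add: "p \<in> carrier (R k) \<Longrightarrow> q \<in> carrier (R k) \<Longrightarrow> p + q \<in> carrier (R k)"
  unfolding in_R using keys_add[of p q] by blast

lemma R_mult:
  assumes "p \<in> carrier (R k)" "q \<in> carrier (R k)"
  shows "p * q \<in> carrier (R k)"
  unfolding in_R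
proof
  fix m assume "m \<in> Poly_Mapping.keys (p * q)"
  then obtain a b where "a \<in> Poly_Mapping.keys p" "b \<in> Poly_Mapping.keys q" "m = a + b"
    using keys_mult[of p q] by blast
  then show "Poly_Mapping.keys m \<subseteq> {..<k}"
    using assms keys_add[of a b] unfolding in_R by blast
qed

lemma R_zero_one: "0 \<in> carrier (R k)" "1 \<in> carrier (R k)"
  by (simp_all add: in_R)

lemma R_sum: "(\<And>i. i \<in> A \<Longrightarrow> f i \<in> carrier (R k)) \<Longrightarrow> sum f A \<in> carrier (R k)"
  by (induction A rule: infinite_finite_induct) (auto simp: R_zero_one intro!: R_add)

lemma R_prod: "(\<And>i. i \<in> A \<Longrightarrow> f i \<in> carrier (R k)) \<Longrightarrow> prod f A \<in> carrier (R k)"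
  by (induction A rule: infinite_finite_induct) (auto simp: R_zero_one intro!: R_mult)

lemma R_var: "j < k \<Longrightarrow> var j \<in> carrier (R k)"
  by (simp add: in_R var_def)

lemma R_const: "const c \<in> carrier (R k)"
  by (simp add: in_R const_def)

lemma cring_R: "cring (R k)"
proof (rule cringI)
  show "abelian_group (R k)"
  proof (rule abelian_groupI)
    fix x assume "x \<in> carrier (R k)"
    then have "- x \<in> carrier (R k)" by (simp add: in_R)
    then show "\<exists>y\<in>carrier (R k). y \<oplus>\<^bsub>R k\<^esub> x = \<zero>\<^bsub>R k\<^esub>"
      by (intro bexI[of _ "- x"]) simp_all
  qed (auto simp: R_add algebra_simps, auto simp: in_R)
  show "Group.comm_monoid (R k)"
    by (rule comm_monoidI) (auto simp: R_mult algebra_simps, auto simp: in_R)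
qed (simp add: algebra_simps)

lemma gens_in_R:
  "{elem_sym k (2 ^ i) var + elem_sym (n - k) (2 ^ i) (lin_form k L) | i. i < r} \<subseteq> carrier (R k)"
  "{var j ^ 2 | j. j < k} \<subseteq> carrier (R k)"
  by (auto simp: elem_sym_def lin_form_def power2_eq_square
      intro!: R_add R_sum R_prod R_mult R_var R_const)

lemma ideal_J': "ideal (J' n r k L) (R k)"
proof -
  interpret cring "R k" by (rule cring_R)
  show ?thesis
    unfolding J'_def Q_def by (intro add_ideals genideal_ideal gens_in_R)
qed

lemma Q_subset_J': "Q k \<subseteq> J' n r k L"
proof -
  interpret cring "R k" by (rule cring_R)
  let ?G = "{elem_sym k (2 ^ i) var + elem_sym (n - k) (2 ^ i) (lin_form k L) | i. i < r}"
  interpret I: ideal "Idl\<^bsub>R k\<^esub> ?G" "R k" by (intro genideal_ideal gens_in_R)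
  have "0 \<in> Idl\<^bsub>R k\<^esub> ?G" using I.zero_closed by simp
  then show ?thesis
    unfolding J'_def set_add_def' by force
qed

lemma dreg_attained: "J' n r k L \<inter> homog k (k + 1) = homog k (k + 1)"
proof -
  interpret cring "R k" by (rule cring_R)
  interpret Q: ideal "Q k" "R k" unfolding Q_def by (intro genideal_ideal gens_in_R)
  have mono: "Poly_Mapping.single m c \<in> Q k"
    if m: "Poly_Mapping.keys m \<subseteq> {..<k}" "total_deg m = k + 1" for m c
  proof -
    obtain j where j: "j \<in> Poly_Mapping.keys m" "Poly_Mapping.lookup m j \<ge> 2"
    proof (rule ccontr)
      assume "\<not> thesis"
      then have "total_deg m \<le> (\<Sum>v \<in> Poly_Mapping.keys m. 1)"
        unfolding total_deg_def using that by (intro sum_mono) (metis not_less_eq_eq numeral_2_eq_2 One_nat_def)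
      also have "\<dots> \<le> k" using card_mono[OF _ m(1)] by simp
      finally show False using m(2) by simp
    qed
    let ?s = "Poly_Mapping.single j (2::nat)"
    have split: "m = (m - ?s) + ?s"
      using j(2) by (intro poly_mapping_eqI)
        (auto simp: lookup_add lookup_minus lookup_single when_def)
    have "Poly_Mapping.keys (m - ?s) \<subseteq> Poly_Mapping.keys m"
      by (auto simp: in_keys_iff lookup_minus)
    then have a: "Poly_Mapping.single (m - ?s) c \<in> carrier (R k)"
      using m(1) unfolding in_R by auto
    have v: "var j ^ 2 = Poly_Mapping.single ?s 1"
      by (simp add: var_def power2_eq_square mult_single single_add[symmetric] numeral_2_eq_2)
    have "var j ^ 2 \<in> Q k"
      unfolding Q_def using genideal_self[OF gens_in_R(2)] j(1) m(1) by blast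
    then have "Poly_Mapping.single (m - ?s) c * var j ^ 2 \<in> Q k"
      using Q.I_l_closed[OF _ a] by simp
    then show ?thesis
      unfolding v mult_single split[symmetric] mult_1_right .
  qed
  have "p \<in> Q k" if p: "p \<in> homog k (k + 1)" for p
  proof -
    have sums: "(\<Sum>m\<in>A. f m) \<in> Q k" if "finite A" "\<And>m. m \<in> A \<Longrightarrow> f m \<in> Q k"
      for A and f :: "(nat \<Rightarrow>\<^sub>0 nat) \<Rightarrow> mpoly2"
      using that Q.a_closed Q.zero_closed
      by (induction A rule: finite_induct) auto
    have "p = (\<Sum>m\<in>Poly_Mapping.keys p. Poly_Mapping.single m (Poly_Mapping.lookup p m))"
      by (rule poly_mapping_eqI)
        (auto simp: lookup_sum lookup_single when_def in_keys_iff sum.delta)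
    moreover have "\<dots> \<in> Q k"
      using p by (intro sums mono) (auto simp: homog_def in_R)
    ultimately show ?thesis by simp
  qed
  then show ?thesis using Q_subset_J' by blast
qed

end

(*
  Work modulo J'. Variables and linear forms square to zero, so in each family the elementary
  symmetric polynomials multiply like divided powers: e_j is the product of the e_(2^i) over the
  binary digits of j. Hence the generators give e_j(x) = e_j(l) for all j < 2^r. Moreover
  e_j(l) = 0 for j > rk L, since any j of the forms are then linearly dependent.

  For a set S of d variables with complement T put P_T(t) = prod_{a in T} (1 + x_a t). As
  P_T^2 = 1, we get P_S = P_X P_T, and comparing coefficients of t^d,
    x_S = sum_j e_j(x) e_(d-j)(T).
  If d < 2^r, the j-th term vanishes unless j <= rk L and d - j <= k - d, so x_S = 0 as soon as
  2 d > k + rk L. Only d = 2^r remains, with k + rk L = 2^(r+1) - 2 or 2^(r+1) - 1.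
  In the first case, the monomial obtained by removing x_i from x_S is a multiple of
  prod_{a in T} x_a * x_i, whence x_S = 0. The second case is the exceptional one: all monomials
  x_S with |S| = 2^r equal e_(2^r)(x), and those of degree 2^r + 1 vanish.
*)
theory Submission
  imports Defs
begin

section \<open>Parity of binomial coefficients\<close>

text \<open>The absorption identity t C(2^i, t) = 2^i C(2^i - 1, t - 1) would make 2^i divide t if
  the binomial coefficient were odd.\<close>

lemma even_choose_power_two:
  assumes "0 < t" "t < 2 ^ i"
  shows "even ((2 ^ i :: nat) choose t)"
proof (rule ccontr)
  assume odd: "odd ((2 ^ i :: nat) choose t)"
  obtain s where s: "t = Suc s" using assms(1) by (cases t) auto
  obtain N where N: "(2 ^ i :: nat) = Suc N" by (metis not0_implies_Suc power_not_zero zero_neq_numeral)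
  have "t * ((2 ^ i :: nat) choose t) = 2 ^ i * (N choose s)"
    unfolding s N by (rule Suc_times_binomial)
  then have "2 ^ i dvd t * ((2 ^ i :: nat) choose t)" by simp
  moreover have "coprime (2 ^ i) ((2 ^ i :: nat) choose t)" using odd by simp
  ultimately have "2 ^ i dvd t" by (simp add: coprime_dvd_mult_left_iff)
  then show False using assms by (auto dest: dvd_imp_le)
qed

text \<open>An instance of Lucas' theorem. In Vandermonde's sum the term t = 2^i is 1, the term t =
  0 vanishes because j < 2^i, and all others are even.\<close>

lemma odd_choose_top_bit:
  assumes "j < 2 ^ i"
  shows "odd ((2 ^ i + j :: nat) choose 2 ^ i)"
proof -
  have "(2 ^ i + j) choose 2 ^ i = (\<Sum>t\<le>2 ^ i. (2 ^ i choose t) * (j choose (2 ^ i - t)))"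
    by (rule vandermonde[symmetric])
  also have "\<dots> = 1 + (\<Sum>t<2 ^ i. (2 ^ i choose t) * (j choose (2 ^ i - t)))"
    by (simp add: lessThan_Suc_atMost[symmetric] del: lessThan_Suc_atMost)
  also have "even (\<Sum>t<2 ^ i. (2 ^ i choose t) * (j choose (2 ^ i - t)))"
  proof (rule dvd_sum)
    fix t :: nat assume "t \<in> {..<2 ^ i}"
    then show "even ((2 ^ i choose t) * (j choose (2 ^ i - t)))"
      using assms even_choose_power_two[of t i] by (cases "t = 0") (auto simp: binomial_eq_0)
  qed
  ultimately show ?thesis by simp
qed

section \<open>Generating polynomials of elementary symmetric polynomials\<close>

text \<open>This is P_T of the overview. The index set is arbitrary because complements of sets of
  variables occur, not only initial segments.\<close>

definition esym_poly :: "'b set \<Rightarrow> ('b \<Rightarrow> 'a::comm_ring_1) \<Rightarrow> 'a poly" where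
  "esym_poly A y = (\<Prod>a\<in>A. [:1, y a:])"

lemma coeff_esym_poly:
  assumes "finite A"
  shows "coeff (esym_poly A y) j = (\<Sum>\<alpha> | \<alpha> \<subseteq> A \<and> card \<alpha> = j. \<Prod>a\<in>\<alpha>. y a)"
proof -
  have "esym_poly A y = (\<Prod>a\<in>A. monom (y a) 1 + 1)"
    unfolding esym_poly_def by (simp add: monom_altdef one_pCons)
  also have "\<dots> = (\<Sum>\<alpha>\<in>Pow A. (\<Prod>a\<in>\<alpha>. monom (y a) 1) * (\<Prod>a\<in>A - \<alpha>. 1))"
    using assms by (rule prod_add)
  also have "\<dots> = (\<Sum>\<alpha>\<in>Pow A. monom (\<Prod>a\<in>\<alpha>. y a) (card \<alpha>))"
  proof (rule sum.cong[OF refl])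
    fix \<alpha> assume "\<alpha> \<in> Pow A"
    then have "finite \<alpha>" using assms finite_subset by auto
    then have "(\<Prod>a\<in>\<alpha>. monom (y a) 1) = monom (\<Prod>a\<in>\<alpha>. y a) (card \<alpha>)"
      by (induction \<alpha> rule: finite_induct) (auto simp: mult_monom)
    then show "(\<Prod>a\<in>\<alpha>. monom (y a) 1) * (\<Prod>a\<in>A - \<alpha>. 1) = monom (\<Prod>a\<in>\<alpha>. y a) (card \<alpha>)"
      by simp
  qed
  finally have "coeff (esym_poly A y) j =
      (\<Sum>\<alpha>\<in>Pow A. if card \<alpha> = j then \<Prod>a\<in>\<alpha>. y a else 0)"
    by (simp add: coeff_sum)
  also have "\<dots> = (\<Sum>\<alpha> | \<alpha> \<subseteq> A \<and> card \<alpha> = j. \<Prod>a\<in>\<alpha>. y a)"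
    using assms by (simp add: sum.If_cases Collect_conj_eq[symmetric] Pow_def)
  finally show ?thesis .
qed

lemma elem_sym_eq_coeff: "elem_sym m j y = coeff (esym_poly {..<m} y) j"
  by (simp add: elem_sym_def coeff_esym_poly)

lemma coeff_esym_poly_0: "finite A \<Longrightarrow> coeff (esym_poly A y) 0 = 1"
  unfolding esym_poly_def coeff_0_prod_list poly_0_coeff_0[symmetric] by (simp add: poly_prod)

lemma coeff_esym_poly_card:
  assumes "finite A"
  shows "coeff (esym_poly A y) (card A) = (\<Prod>a\<in>A. y a)"
proof -
  have "{\<alpha>. \<alpha> \<subseteq> A \<and> card \<alpha> = card A} = {A}"
    using assms by (auto dest: card_subset_eq)
  then show ?thesis using assms by (simp add: coeff_esym_poly)
qed

lemma coeff_esym_poly_eq_0: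
  assumes "finite A" "card A < j"
  shows "coeff (esym_poly A y) j = 0"
proof -
  have "{\<alpha>. \<alpha> \<subseteq> A \<and> card \<alpha> = j} = {}"
    using assms by (auto dest: card_mono)
  then show ?thesis using assms by (simp only: coeff_esym_poly sum.empty)
qed

lemma esym_poly_insert:
  "finite A \<Longrightarrow> a \<notin> A \<Longrightarrow> esym_poly (insert a A) y = [:1, y a:] * esym_poly A y"
  by (simp add: esym_poly_def)

lemma esym_poly_Un:
  "finite A \<Longrightarrow> finite B \<Longrightarrow> A \<inter> B = {} \<Longrightarrow> esym_poly (A \<union> B) y = esym_poly A y * esym_poly B y"
  by (simp add: esym_poly_def prod.union_disjoint)

section \<open>Congruences modulo an ideal in characteristic two\<close>

text \<open>Models an ideal \<open>I\<close> of a subring \<open>C\<close> of a type-class ring.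
  Thus sums, products and \<open>poly\<close> of the ambient type are available, although
  \<open>J'\<close> is only an ideal of \<open>carrier (R k)\<close>.\<close>

locale char2_ideal =
  fixes C I :: "'a::comm_ring_1 set"
  assumes one_in: "1 \<in> C"
    and diff_in: "a \<in> C \<Longrightarrow> b \<in> C \<Longrightarrow> a - b \<in> C"
    and mult_in: "a \<in> C \<Longrightarrow> b \<in> C \<Longrightarrow> a * b \<in> C"
    and ideal_subset: "I \<subseteq> C"
    and ideal_zero: "0 \<in> I"
    and ideal_diff: "a \<in> I \<Longrightarrow> b \<in> I \<Longrightarrow> a - b \<in> I"
    and ideal_mult: "a \<in> C \<Longrightarrow> b \<in> I \<Longrightarrow> a * b \<in> I"
    and two_eq_0: "(1::'a) + 1 = 0"
begin

text \<open>Membership in \<open>C\<close> is built in, so that products of congruences need no side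
  conditions; reflexivity then holds on \<open>C\<close> only.\<close>

definition cong (infix "\<simeq>" 50) where
  "a \<simeq> b \<longleftrightarrow> a \<in> C \<and> b \<in> C \<and> a - b \<in> I"

definition pcong (infix "\<simeq>\<^sub>p" 50) where
  "p \<simeq>\<^sub>p q \<longleftrightarrow> (\<forall>j. coeff p j \<simeq> coeff q j)"

lemma zero_in: "0 \<in> C"
  using ideal_subset ideal_zero by blast

lemma uminus_eq: "- a = (a::'a)"
proof -
  have "a + a = (1 + 1) * a" by (simp add: distrib_right)
  then show ?thesis using two_eq_0 by (simp add: minus_equation_iff eq_neg_iff_add_eq_0)
qed

lemma diff_eq_add: "a - b = a + (b::'a)"
  by (metis diff_conv_add_uminus uminus_eq)

lemma add_in: "a \<in> C \<Longrightarrow> b \<in> C \<Longrightarrow> a + b \<in> C"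
  using diff_in[of a b] by (simp add: diff_eq_add)

lemma ideal_add: "a \<in> I \<Longrightarrow> b \<in> I \<Longrightarrow> a + b \<in> I"
  using ideal_diff[of a b] by (simp add: diff_eq_add)

lemma ideal_mult_right: "a \<in> I \<Longrightarrow> b \<in> C \<Longrightarrow> a * b \<in> I"
  using ideal_mult[of b a] by (simp add: mult.commute)

lemma cong_refl: "a \<in> C \<Longrightarrow> a \<simeq> a"
  by (simp add: cong_def ideal_zero)

lemma cong_sym: "a \<simeq> b \<Longrightarrow> b \<simeq> a"
  by (simp add: cong_def diff_eq_add add.commute)

lemma cong_trans [trans]: "a \<simeq> b \<Longrightarrow> b \<simeq> c \<Longrightarrow> a \<simeq> c"
  using ideal_add[of "a - b" "b - c"] by (simp add: cong_def)

lemma cong_add: "a \<simeq> b \<Longrightarrow> c \<simeq> d \<Longrightarrow> a + c \<simeq> b + d"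
  using ideal_add[of "a - b" "c - d"] by (simp add: cong_def add_in algebra_simps)

lemma cong_mult:
  assumes "a \<simeq> b" "c \<simeq> d"
  shows "a * c \<simeq> b * d"
proof -
  have "a * c - b * d = a * (c - d) + d * (a - b)" by (simp add: algebra_simps)
  also have "\<dots> \<in> I" using assms by (intro ideal_add ideal_mult) (auto simp: cong_def)
  finally show ?thesis using assms by (simp add: cong_def mult_in)
qed

lemma cong_0_iff: "a \<simeq> 0 \<longleftrightarrow> a \<in> I"
  using ideal_subset by (auto simp: cong_def zero_in)

lemma cong_sum:
  "(\<And>i. i \<in> A \<Longrightarrow> f i \<simeq> g i) \<Longrightarrow> sum f A \<simeq> sum g A"
  by (induction A rule: infinite_finite_induct) (auto intro: cong_add cong_refl zero_in)

lemma prod_in: "(\<And>i. i \<in> A \<Longrightarrow> f i \<in> C) \<Longrightarrow> prod f A \<in> C"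
  by (induction A rule: infinite_finite_induct) (auto intro: mult_in one_in)

lemma of_nat_in: "of_nat m \<in> C"
  by (induction m) (auto intro: add_in one_in zero_in)

lemma of_nat_char2: "of_nat m = (if even m then 0 else (1::'a))"
  by (induction m) (use two_eq_0 in auto)

lemma pcong_mult: "p \<simeq>\<^sub>p q \<Longrightarrow> s \<simeq>\<^sub>p t \<Longrightarrow> p * s \<simeq>\<^sub>p q * t"
  unfolding pcong_def coeff_mult by (auto intro!: cong_sum cong_mult)

lemma coeff_esym_poly_in:
  "(\<And>a. a \<in> A \<Longrightarrow> y a \<in> C) \<Longrightarrow> coeff (esym_poly A y) j \<in> C"
proof (induction A arbitrary: j rule: infinite_finite_induct)
  case (insert a A)
  then show ?case
    by (cases j) (auto simp: esym_poly_insert coeff_pCons intro: add_in mult_in)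
qed (auto simp: esym_poly_def coeff_1 intro: one_in zero_in)

lemma esym_poly_refl:
  "(\<And>a. a \<in> A \<Longrightarrow> y a \<in> C) \<Longrightarrow> esym_poly A y \<simeq>\<^sub>p esym_poly A y"
  by (simp add: pcong_def cong_refl coeff_esym_poly_in)

text \<open>As 2 y_a = 0, each factor squares to 1 + y_a^2 t^2, which is 1 modulo \<open>I\<close>.
  Hence the generating polynomial is its own inverse.\<close>

lemma esym_poly_square:
  assumes "\<And>a. a \<in> A \<Longrightarrow> y a \<in> C" "\<And>a. a \<in> A \<Longrightarrow> y a ^ 2 \<in> I"
  shows "esym_poly A y * esym_poly A y \<simeq>\<^sub>p 1"
  using assms
proof (induction A rule: infinite_finite_induct)
  case (insert a A)
  have "y a + y a = 0" using diff_eq_add[of "y a" "y a"] by simp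
  then have "[:1, y a:] * [:1, y a:] = [:1, 0, y a ^ 2:]" by (simp add: power2_eq_square)
  also have "\<dots> \<simeq>\<^sub>p 1"
    using insert.prems(2)[of a]
    by (auto simp: pcong_def coeff_pCons coeff_1 one_pCons cong_0_iff split: nat.split
        intro: cong_refl one_in zero_in ideal_zero)
  finally have "([:1, y a:] * [:1, y a:]) * (esym_poly A y * esym_poly A y) \<simeq>\<^sub>p 1 * 1"
    using insert by (intro pcong_mult) auto
  then show ?case using insert.hyps by (simp only: esym_poly_insert[OF insert.hyps] mult_1 mult_ac)
qed (auto simp: esym_poly_def pcong_def coeff_1 intro: cong_refl one_in zero_in)

text \<open>When all \<open>y a ^ 2\<close> vanish, \<open>e\<^sub>i\<close> behaves like the divided power \<open>e\<^sub>1 ^ i / i!\<close>.\<close>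

lemma esym_mult_esym:
  assumes "\<And>a. a \<in> A \<Longrightarrow> y a \<in> C" "\<And>a. a \<in> A \<Longrightarrow> y a ^ 2 \<in> I"
  shows "coeff (esym_poly A y) i * coeff (esym_poly A y) j
    \<simeq> of_nat ((i + j) choose i) * coeff (esym_poly A y) (i + j)"
  using assms
proof (induction A arbitrary: i j rule: infinite_finite_induct)
  case (insert a A)
  let ?e = "coeff (esym_poly A y)" and ?f = "coeff (esym_poly (insert a A) y)"
  note IH = insert.IH[OF insert.prems, simplified]
  have f_Suc: "?f (Suc i) = ?e (Suc i) + y a * ?e i" for i
    using insert.hyps by (simp add: esym_poly_insert coeff_pCons)
  have f_0: "?f 0 = 1" using insert.hyps by (simp add: coeff_esym_poly_0)
  have e_in: "?e i \<in> C" for i using insert.prems by (intro coeff_esym_poly_in) auto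
  have f_in: "?f i \<in> C" for i using insert.prems by (intro coeff_esym_poly_in) auto
  have ya: "y a \<in> C" "y a ^ 2 \<simeq> 0" using insert.prems by (auto simp: cong_0_iff)
  show ?case
  proof (cases "i = 0 \<or> j = 0")
    case True
    then show ?thesis by (elim disjE) (simp_all add: f_0 cong_refl f_in)
  next
    case False
    then obtain u v where uv: "i = Suc u" "j = Suc v" by (auto simp: gr0_conv_Suc)
    let ?N = "Suc (u + v)"
    have pascal: "?e (Suc u) * ?e (Suc v) \<simeq> of_nat (Suc ?N choose Suc u) * ?e (Suc ?N)"
      "?e u * ?e (Suc v) \<simeq> of_nat (?N choose u) * ?e ?N"
      "?e (Suc u) * ?e v \<simeq> of_nat (?N choose Suc u) * ?e ?N"
      using IH[of "Suc u" "Suc v"] IH[of u "Suc v"] IH[of "Suc u" v] by (simp_all del: binomial_Suc_Suc)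
    have "?f i * ?f j = ?e (Suc u) * ?e (Suc v)
        + y a * (?e u * ?e (Suc v) + ?e (Suc u) * ?e v) + y a ^ 2 * (?e u * ?e v)"
      unfolding uv f_Suc by (simp add: algebra_simps power2_eq_square)
    also have "\<dots> \<simeq> of_nat (Suc ?N choose Suc u) * ?e (Suc ?N)
        + y a * (of_nat (?N choose u) * ?e ?N + of_nat (?N choose Suc u) * ?e ?N)
        + 0 * (?e u * ?e v)"
      by (rule cong_add[OF cong_add[OF pascal(1) cong_mult[OF cong_refl cong_add[OF pascal(2,3)]]]
            cong_mult[OF ya(2) cong_refl]])
        (rule ya mult_in e_in)+
    \<comment> \<open>Pascal's rule merges the two binomial coefficients of the middle term into the
      one of the first term.\<close>
    also have "\<dots> = of_nat ((i + j) choose i) * ?f (i + j)"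
      unfolding uv by (simp add: f_Suc algebra_simps)
    finally show ?thesis .
  qed
qed (auto simp: esym_poly_def coeff_1 intro!: cong_refl intro: one_in zero_in mult_in of_nat_in)

lemma ideal_sum: "(\<And>i. i \<in> A \<Longrightarrow> f i \<in> I) \<Longrightarrow> sum f A \<in> I"
  by (induction A rule: infinite_finite_induct) (auto intro: ideal_add ideal_zero)

lemma cong_ideal: "a \<simeq> b \<Longrightarrow> b \<in> I \<Longrightarrow> a \<in> I"
  using cong_trans[of a b 0] by (simp add: cong_0_iff)

text \<open>The binomial coefficient in \<open>esym_mult_esym\<close> is odd here, hence 1 in
  characteristic two.\<close>

lemma esym_mult_top_bit:
  assumes "\<And>a. a \<in> A \<Longrightarrow> y a \<in> C" "\<And>a. a \<in> A \<Longrightarrow> y a ^ 2 \<in> I" "j < 2 ^ i"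
  shows "coeff (esym_poly A y) (2 ^ i) * coeff (esym_poly A y) j \<simeq> coeff (esym_poly A y) (2 ^ i + j)"
  using esym_mult_esym[of A y "2 ^ i" j] assms odd_choose_top_bit[OF assms(3)]
  by (simp add: of_nat_char2)

text \<open>Strong induction on j: splitting off the leading binary digit 2^i factors e_j as e_(2^i)
  e_(j - 2^i) in both families.\<close>

lemma esym_cong_of_powers:
  assumes "finite A" "finite B"
    and "\<And>a. a \<in> A \<Longrightarrow> y a \<in> C" "\<And>a. a \<in> A \<Longrightarrow> y a ^ 2 \<in> I"
    and "\<And>b. b \<in> B \<Longrightarrow> z b \<in> C" "\<And>b. b \<in> B \<Longrightarrow> z b ^ 2 \<in> I"
    and powers: "\<And>i. i < r \<Longrightarrow> coeff (esym_poly A y) (2 ^ i) \<simeq> coeff (esym_poly B z) (2 ^ i)"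
    and "j < 2 ^ r"
  shows "coeff (esym_poly A y) j \<simeq> coeff (esym_poly B z) j"
  using \<open>j < 2 ^ r\<close>
proof (induction j rule: less_induct)
  case (less j)
  show ?case
  proof (cases "j = 0")
    case True
    then show ?thesis
      using assms(1,2) by (simp add: coeff_esym_poly_0 cong_refl one_in)
  next
    case False
    then obtain i where i: "2 ^ i \<le> j" "j < 2 ^ (i + 1)"
      using ex_power_ivl1[of 2 j] by auto
    define u where "u = j - 2 ^ i"
    have u: "j = 2 ^ i + u" "u < 2 ^ i" "u < j" using i by (auto simp: u_def)
    have "(2::nat) ^ i < 2 ^ r" using i(1) less.prems by linarith
    then have "i < r" by simp
    have "coeff (esym_poly A y) j \<simeq> coeff (esym_poly A y) (2 ^ i) * coeff (esym_poly A y) u"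
      unfolding u(1) by (rule cong_sym, rule esym_mult_top_bit[OF assms(3,4) u(2)])
    also have "\<dots> \<simeq> coeff (esym_poly B z) (2 ^ i) * coeff (esym_poly B z) u"
      using less.prems u(3) \<open>i < r\<close> by (intro cong_mult powers less.IH) auto
    also have "\<dots> \<simeq> coeff (esym_poly B z) j"
      unfolding u(1) by (rule esym_mult_top_bit[OF assms(5,6) u(2)])
    finally show ?thesis .
  qed
qed

text \<open>One factor y_b with b in \<open>B\<close> is the sum of the others in \<open>B\<close>.
  After substitution every summand contains some y_a twice.\<close>

lemma prod_in_ideal_of_dependent:
  assumes "finite A" "B \<subseteq> A" "B \<noteq> {}" "(\<Sum>b\<in>B. y b) = 0"
    and "\<And>a. a \<in> A \<Longrightarrow> y a \<in> C" "\<And>a. a \<in> A \<Longrightarrow> y a ^ 2 \<in> I"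
  shows "(\<Prod>a\<in>A. y a) \<in> I"
proof -
  obtain b where b: "b \<in> B" using assms(3) by blast
  have fin: "finite B" using assms(1,2) finite_subset by blast
  have "y b + (\<Sum>a\<in>B - {b}. y a) = 0" using assms(4) sum.remove[OF fin b, of y] by simp
  then have yb: "y b = (\<Sum>a\<in>B - {b}. y a)" by (simp add: eq_neg_iff_add_eq_0[symmetric] uminus_eq)
  have "(\<Prod>a\<in>A. y a) = y b * (\<Prod>a\<in>A - {b}. y a)"
    using assms(1,2) b by (intro prod.remove) auto
  also have "\<dots> = (\<Sum>a\<in>B - {b}. y a * (\<Prod>a\<in>A - {b}. y a))"
    by (subst yb) (rule sum_distrib_right)
  also have "\<dots> \<in> I"
  proof (rule ideal_sum)
    fix a assume a: "a \<in> B - {b}"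
    have "(\<Prod>a\<in>A - {b}. y a) = y a * (\<Prod>a\<in>A - {b} - {a}. y a)"
      using a assms(1,2) by (intro prod.remove) auto
    then have "y a * (\<Prod>a\<in>A - {b}. y a) = y a ^ 2 * (\<Prod>a\<in>A - {b} - {a}. y a)"
      by (simp add: power2_eq_square)
    also have "\<dots> \<in> I"
      using a assms(2,5,6) by (intro ideal_mult_right prod_in) auto
    finally show "y a * (\<Prod>a\<in>A - {b}. y a) \<in> I" .
  qed
  finally show ?thesis .
qed

end

section \<open>Squarefree products modulo the relations\<close>

text \<open>Collects what the degree argument needs from \<open>J'\<close>: \<open>x\<close> stands
  for the variables, \<open>z\<close> for the linear forms and \<rho> for the rank. The generators
  become \<open>powers\<close>, and linear dependence becomes \<open>above_rank\<close>.\<close>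

locale esym_relations = char2_ideal C I for C I :: "'a::comm_ring_1 set" +
  fixes X :: "'b set" and x :: "'b \<Rightarrow> 'a" and Z :: "'c set" and z :: "'c \<Rightarrow> 'a" and r \<rho> :: nat
  assumes finite_X: "finite X" and finite_Z: "finite Z"
    and x_in: "a \<in> X \<Longrightarrow> x a \<in> C" and x_square: "a \<in> X \<Longrightarrow> x a ^ 2 \<in> I"
    and z_in: "b \<in> Z \<Longrightarrow> z b \<in> C" and z_square: "b \<in> Z \<Longrightarrow> z b ^ 2 \<in> I"
    and powers: "i < r \<Longrightarrow> coeff (esym_poly X x) (2 ^ i) \<simeq> coeff (esym_poly Z z) (2 ^ i)"
    and above_rank: "\<rho> < j \<Longrightarrow> coeff (esym_poly Z z) j \<in> I"
begin

lemma low_esym: "j < 2 ^ r \<Longrightarrow> coeff (esym_poly X x) j \<simeq> coeff (esym_poly Z z) j"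
  by (rule esym_cong_of_powers[OF finite_X finite_Z x_in x_square z_in z_square powers])

text \<open>Multiplying P_X = P_S P_(X - S) by P_(X - S), whose square is 1, isolates P_S; its top
  coefficient is the product over \<open>S\<close>.\<close>

lemma prod_cong_sum:
  assumes "S \<subseteq> X"
  shows "(\<Prod>a\<in>S. x a) \<simeq>
    (\<Sum>j\<le>card S. coeff (esym_poly X x) j * coeff (esym_poly (X - S) x) (card S - j))"
proof -
  have fin: "finite S" "finite (X - S)" using assms finite_X finite_subset by auto
  have X: "esym_poly X x = esym_poly S x * esym_poly (X - S) x"
    using esym_poly_Un[of S "X - S" x] fin assms by (simp add: Un_absorb1)
  have "esym_poly S x * (esym_poly (X - S) x * esym_poly (X - S) x) \<simeq>\<^sub>p esym_poly S x * 1"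
    using assms by (intro pcong_mult esym_poly_refl esym_poly_square x_in x_square) auto
  then have "esym_poly X x * esym_poly (X - S) x \<simeq>\<^sub>p esym_poly S x"
    by (simp add: X mult_ac)
  then have "coeff (esym_poly X x * esym_poly (X - S) x) (card S) \<simeq> (\<Prod>a\<in>S. x a)"
    using fin(1) coeff_esym_poly_card[of S x] by (metis pcong_def)
  then show ?thesis by (simp add: coeff_mult cong_sym)
qed

text \<open>If \<rho> < j, the left factor is congruent to e_j(z), which vanishes. Otherwise the
  degree \<open>card S - j\<close> exceeds the number of elements of \<open>X - S\<close>, so the
  right factor is 0.\<close>

lemma low_term:
  assumes "S \<subseteq> X" "j < 2 ^ r" "j \<le> card S" "\<rho> < j \<or> card X + j < 2 * card S"
  shows "coeff (esym_poly X x) j * coeff (esym_poly (X - S) x) (card S - j) \<in> I"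
proof (cases "\<rho> < j")
  case True
  then have "coeff (esym_poly X x) j \<in> I"
    using cong_ideal[OF low_esym[OF assms(2)] above_rank] by simp
  then show ?thesis by (intro ideal_mult_right coeff_esym_poly_in x_in) auto
next
  case False
  have "card (X - S) = card X - card S"
    using assms(1) finite_X finite_subset by (intro card_Diff_subset) auto
  then have "coeff (esym_poly (X - S) x) (card S - j) = 0"
    using False assms finite_X card_mono[OF finite_X assms(1)] by (intro coeff_esym_poly_eq_0) auto
  then show ?thesis by (simp add: ideal_zero)
qed

text \<open>Every index j of the expansion satisfies an alternative of \<open>low_term\<close>: if j
  is at most \<rho>, then \<open>card X + j\<close> is still below
  \<open>2 * card S\<close>.\<close>

lemma prod_in_ideal_of_lt:
  assumes "S \<subseteq> X" "card S < 2 ^ r" "card X + \<rho> < 2 * card S"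
  shows "(\<Prod>a\<in>S. x a) \<in> I"
  by (rule cong_ideal[OF prod_cong_sum[OF assms(1)]], intro ideal_sum low_term[OF assms(1)])
    (use assms in auto)

text \<open>The argument for smaller sets kills all terms but j = 2^r, where \<open>low_esym\<close>
  says nothing; the cofactor of that term is a constant coefficient, that is, 1.\<close>

lemma prod_cong_of_eq:
  assumes "S \<subseteq> X" "card S = 2 ^ r" "card X + \<rho> < 2 * 2 ^ r"
  shows "(\<Prod>a\<in>S. x a) \<simeq> coeff (esym_poly X x) (2 ^ r)"
proof -
  let ?t = "\<lambda>j. coeff (esym_poly X x) j * coeff (esym_poly (X - S) x) (2 ^ r - j)"
  have "(\<Prod>a\<in>S. x a) \<simeq> (\<Sum>j\<le>2 ^ r. ?t j)"
    using prod_cong_sum[OF assms(1)] by (simp add: assms(2))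
  also have "\<dots> = (\<Sum>j<2 ^ r. ?t j) + coeff (esym_poly X x) (2 ^ r)"
    using finite_X by (simp add: lessThan_Suc_atMost[symmetric] coeff_esym_poly_0)
  also have "\<dots> \<simeq> 0 + coeff (esym_poly X x) (2 ^ r)"
  proof (rule cong_add)
    have "(\<Sum>j<2 ^ r. ?t j) \<in> I"
    proof (rule ideal_sum)
      fix j assume "j \<in> {..<2 ^ r :: nat}"
      then show "?t j \<in> I" using low_term[OF assms(1), of j] assms(2,3)
        by (cases "\<rho> < j") auto
    qed
    then show "(\<Sum>j<2 ^ r. ?t j) \<simeq> 0" by (simp add: cong_0_iff)
  qed (intro cong_refl coeff_esym_poly_in x_in)
  finally show ?thesis by simp
qed

text \<open>Removing one element i from \<open>S\<close> leaves S' with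
  \<open>card X + \<rho> = 2 * card S'\<close>, just missing the strict bound. So at most the term j
  = \<rho> survives for S', and the factor x_i kills it.\<close>

lemma prod_in_ideal_of_eq:
  assumes "S \<subseteq> X" "card S = 2 ^ r" "card X + \<rho> + 2 = 2 * 2 ^ r"
  shows "(\<Prod>a\<in>S. x a) \<in> I"
proof -
  have fin: "finite S" using assms(1) finite_X finite_subset by blast
  obtain i where i: "i \<in> S" using assms(2) by fastforce
  define S' where "S' = S - {i}"
  have S': "S' \<subseteq> X" "i \<in> X" "i \<notin> S'" using assms(1) i by (auto simp: S'_def)
  have card_S': "card S' + 1 = 2 ^ r" using fin i assms(2) by (simp add: S'_def card_Suc_Diff1)
  have card_T': "card (X - S') + card S' = card X"
    using S'(1) finite_X finite_subset[OF S'(1)] card_mono[OF finite_X S'(1)]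
    by (simp add: card_Diff_subset)
  let ?t = "\<lambda>j. coeff (esym_poly X x) j * coeff (esym_poly (X - S') x) (card S' - j)"
  have "(\<Prod>a\<in>S. x a) = x i * (\<Prod>a\<in>S'. x a)"
    unfolding S'_def by (rule prod.remove[OF fin i])
  also have "\<dots> \<simeq> x i * (\<Sum>j\<le>card S'. ?t j)"
    by (intro cong_mult prod_cong_sum cong_refl x_in S')
  finally have *: "(\<Prod>a\<in>S. x a) \<simeq> (\<Sum>j\<le>card S'. x i * ?t j)"
    by (simp add: sum_distrib_left)
  show ?thesis
  proof (rule cong_ideal[OF *], rule ideal_sum)
    fix j assume "j \<in> {..card S'}"
    then have j: "j \<le> card S'" by simp
    show "x i * ?t j \<in> I"
    proof (cases "j = \<rho>")
      case True
      \<comment> \<open>The cofactor is now the top coefficient, the product over all of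
        \<open>X - S'\<close>, which already contains x_i.\<close>
      then have "card S' - j = card (X - S')" using j card_S' card_T' assms(3) by linarith
      then have "?t j = coeff (esym_poly X x) j * (x i * (\<Prod>a\<in>X - S' - {i}. x a))"
        using S' finite_X by (simp add: coeff_esym_poly_card prod.remove[of "X - S'" i])
      then have "x i * ?t j = x i ^ 2 * (coeff (esym_poly X x) j * (\<Prod>a\<in>X - S' - {i}. x a))"
        by (simp add: power2_eq_square mult_ac)
      also have "\<dots> \<in> I"
        using S' by (intro ideal_mult_right x_square mult_in prod_in coeff_esym_poly_in x_in) auto
      finally show ?thesis .
    next
      case False
      then have "?t j \<in> I"
        using low_term[OF S'(1), of j] j card_S' card_T' assms(3) by linarith
      then show ?thesis using ideal_mult[OF x_in[OF S'(2)]] by blast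
    qed
  qed
qed

text \<open>All products of \<open>2 ^ r\<close> distinct elements agree, so one factor can be traded to create a square.\<close>

lemma prod_in_ideal_of_Suc:
  assumes "S \<subseteq> X" "card S = 2 ^ r + 1" "card X + \<rho> < 2 * 2 ^ r"
  shows "(\<Prod>a\<in>S. x a) \<in> I"
proof -
  have fin: "finite S" using assms(1) finite_X finite_subset by blast
  obtain i where i: "i \<in> S" using assms(2) by fastforce
  have "card (S - {i}) = 2 ^ r" using i assms(2) by simp
  then have "S - {i} \<noteq> {}" by (metis card.empty power_not_zero zero_neq_numeral)
  then obtain j where j: "j \<in> S" "j \<noteq> i" by blast
  have "(\<Prod>a\<in>S - {i}. x a) \<simeq> (\<Prod>a\<in>S - {j}. x a)"
    using assms i j by (intro cong_trans[OF prod_cong_of_eq cong_sym[OF prod_cong_of_eq]]) auto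
  then have "x i * (\<Prod>a\<in>S - {i}. x a) \<simeq> x i * (\<Prod>a\<in>S - {j}. x a)"
    using assms(1) i by (intro cong_mult cong_refl x_in) auto
  also have "(\<Prod>a\<in>S - {j}. x a) = x i * (\<Prod>a\<in>S - {j} - {i}. x a)"
    using fin i j by (intro prod.remove) auto
  finally have "(\<Prod>a\<in>S. x a) \<simeq> x i ^ 2 * (\<Prod>a\<in>S - {j} - {i}. x a)"
    by (simp add: prod.remove[OF fin i] power2_eq_square mult.assoc)
  moreover have "x i ^ 2 * (\<Prod>a\<in>S - {j} - {i}. x a) \<in> I"
    using assms(1) i by (intro ideal_mult_right x_square prod_in x_in) auto
  ultimately show ?thesis by (rule cong_ideal)
qed

end

section \<open>Matrix rank and linear dependence over F_2\<close>

lemma UNIV_bit_eq: "(UNIV :: bit set) = {0, 1}"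
proof -
  have "a \<in> {0, 1}" for a :: bit by (cases a) simp_all
  then show ?thesis by blast
qed

lemma bit_add_self: "(a::bit) + a = 0"
  by (cases a) simp_all

text \<open>A column outside the span of \<open>U\<close> could be added to \<open>U\<close> without
  losing independence.\<close>

lemma (in vec_space) cols_subset_span_maximal:
  assumes "A \<in> carrier_mat n nc"
    and "maximal U (\<lambda>T. T \<subseteq> set (cols A) \<and> lin_indpt T)"
  shows "set (cols A) \<subseteq> span U"
proof
  fix s assume s: "s \<in> set (cols A)"
  have U: "U \<subseteq> set (cols A)" "lin_indpt U" using assms(2) by (auto simp: maximal_def)
  have cols: "set (cols A) \<subseteq> carrier_vec n" using assms(1) cols_dim by blast
  show "s \<in> span U"
  proof (rule ccontr)
    assume *: "s \<notin> span U"
    have "U \<subseteq> carrier_vec n" using U cols by blast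
    then have "s \<notin> U" using * span_mem by auto
    moreover have "lin_indpt (U \<union> {s})"
      using lin_dep_iff_in_span[of U s] U cols s * \<open>s \<notin> U\<close> by auto
    ultimately show False using assms(2) s U(1) unfolding maximal_def by blast
  qed
qed

text \<open>\<open>rank\<close> is a column rank, while a relation between rows is wanted. Over F_2
  counting supplies it: two subsets of \<open>A\<close> have equal row sums on a column basis, so
  the rows in their symmetric difference sum to zero on the basis and, by linearity, on every
  column.\<close>

lemma dependent_rows:
  fixes L :: "bit mat"
  assumes L: "L \<in> carrier_mat m k" and A: "A \<subseteq> {..<m}" "vec_space.rank m L < card A"
  obtains B where "B \<subseteq> A" "B \<noteq> {}" "\<And>j. j < k \<Longrightarrow> (\<Sum>a\<in>B. L $$ (a, j)) = 0"
proof -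
  interpret vec_space "TYPE(bit)" m .
  have finA: "finite A" using A(1) finite_subset by blast
  obtain U where U: "finite U" "maximal U (\<lambda>T. T \<subseteq> set (cols L) \<and> lin_indpt T)"
    using maximal_exists_superset[of "set (cols L)" "\<lambda>T. T \<subseteq> set (cols L) \<and> lin_indpt T" "{}"]
      finite_lin_indpt2[of "{}"] by auto
  have U_sub: "U \<subseteq> carrier_vec m"
    using U(2) L cols_dim[of L] by (auto simp: maximal_def)
  define \<phi> where "\<phi> B v = (\<Sum>a\<in>B. v $ a)" for B and v :: "bit vec"
  \<comment> \<open>The \<open>2 ^ card A\<close> subsets of \<open>A\<close> have at most \<open>2 ^ rank\<close> distinct row sums on a column basis \<open>U\<close>.\<close>
  have "\<not> inj_on (\<lambda>B. restrict (\<phi> B) U) (Pow A)"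
  proof
    assume "inj_on (\<lambda>B. restrict (\<phi> B) U) (Pow A)"
    moreover have "(\<lambda>B. restrict (\<phi> B) U) ` Pow A \<subseteq> U \<rightarrow>\<^sub>E UNIV" by auto
    moreover have "finite (U \<rightarrow>\<^sub>E (UNIV :: bit set))"
      using U(1) by (intro finite_PiE) (auto simp: UNIV_bit_eq)
    ultimately have "card (Pow A) \<le> card (U \<rightarrow>\<^sub>E (UNIV :: bit set))"
      by (metis card_inj_on_le)
    also have "card (U \<rightarrow>\<^sub>E (UNIV :: bit set)) = 2 ^ card U"
      using U(1) by (simp add: card_PiE UNIV_bit_eq numeral_2_eq_2)
    finally have "card A \<le> card U" using finA by (simp add: card_Pow)
    then show False using A(2) rank_card_indpt[OF L U(2)] by simp
  qed
  then obtain B1 B2 where B: "B1 \<subseteq> A" "B2 \<subseteq> A" "B1 \<noteq> B2"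
    "restrict (\<phi> B1) U = restrict (\<phi> B2) U"
    by (auto simp: inj_on_def)
  have finB: "finite B1" "finite B2" using B finA finite_subset by auto
  \<comment> \<open>Rows common to both subsets cancel in characteristic two.\<close>
  define B where "B = (B1 - B2) \<union> (B2 - B1)"
  have \<phi>_B: "\<phi> B v = \<phi> B1 v + \<phi> B2 v" for v
  proof -
    have "\<phi> B1 v = \<phi> (B1 \<inter> B2) v + \<phi> (B1 - B2) v"
      unfolding \<phi>_def using finB by (intro sum.Int_Diff)
    moreover have "\<phi> B2 v = \<phi> (B1 \<inter> B2) v + \<phi> (B2 - B1) v"
      unfolding \<phi>_def using finB by (subst Int_commute) (intro sum.Int_Diff)
    moreover have "\<phi> B v = \<phi> (B1 - B2) v + \<phi> (B2 - B1) v"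
      unfolding B_def \<phi>_def using finB by (intro sum.union_disjoint) auto
    moreover have "c + a + (c + b) = a + b" for a b c :: bit
    proof -
      have "c + a + (c + b) = (c + c) + (a + b)" by (simp only: ac_simps)
      then show ?thesis by (simp only: bit_add_self add_0)
    qed
    ultimately show ?thesis by (simp only:)
  qed
  have BA: "B \<subseteq> A" "B \<noteq> {}" using B by (auto simp: B_def)
  have on_U: "\<phi> B u = 0" if "u \<in> U" for u
    using fun_cong[OF B(4), of u] that by (simp add: \<phi>_B bit_add_self)
  have on_span: "\<phi> B v = 0" if v: "v \<in> span U" for v
  proof -
    obtain c where c: "v = lincomb c U"
      using v finite_span[OF U(1) U_sub] by auto
    have "\<phi> B v = (\<Sum>a\<in>B. \<Sum>u\<in>U. c u * u $ a)"
      unfolding \<phi>_def c using BA(1) A(1) U_sub by (intro sum.cong refl lincomb_index) auto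
    also have "\<dots> = (\<Sum>u\<in>U. c u * \<phi> B u)"
      unfolding \<phi>_def sum_distrib_left by (rule sum.swap)
    also have "\<dots> = 0" using on_U by simp
    finally show ?thesis .
  qed
  show thesis
  proof (rule that[OF BA])
    fix j assume j: "j < k"
    then have "col L j \<in> set (cols L)" using L by (auto simp: cols_def)
    then have "\<phi> B (col L j) = 0"
      using cols_subset_span_maximal[OF L U(2)] on_span by blast
    moreover have "\<phi> B (col L j) = (\<Sum>a\<in>B. L $$ (a, j))"
      unfolding \<phi>_def using BA(1) A(1) L j by (intro sum.cong refl) auto
    ultimately show "(\<Sum>a\<in>B. L $$ (a, j)) = 0" by simp
  qed
qed

lemma (in vec_space) rank_le_nr:
  assumes "A \<in> carrier_mat n nc"
  shows "rank A \<le> n"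
proof -
  obtain U where U: "finite U" "maximal U (\<lambda>T. T \<subseteq> set (cols A) \<and> lin_indpt T)"
    using maximal_exists_superset[of "set (cols A)" "\<lambda>T. T \<subseteq> set (cols A) \<and> lin_indpt T" "{}"]
      finite_lin_indpt2[of "{}"] by auto
  have "U \<subseteq> carrier_vec n" "lin_indpt U"
    using U(2) assms cols_dim[of A] by (auto simp: maximal_def)
  then show ?thesis using li_le_dim(2)[OF fin_dim] rank_card_indpt[OF assms U(2)] by (simp add: dim_is_n)
qed

section \<open>Transfer to the polynomial ring and its ideals\<close>

lemma const_add: "const (a + b) = const a + const b"
  unfolding const_def by (rule single_add)

lemma const_0: "const 0 = 0"
  by (simp add: const_def)

lemma const_sum: "const (sum f A) = (\<Sum>a\<in>A. const (f a))"
  using sum_comp_morphism[of const f A, OF const_0 const_add] by (simp add: o_def)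

text \<open>Turns a relation between rows of \<open>L\<close> into one between linear forms.\<close>

lemma sum_lin_form:
  "(\<Sum>a\<in>B. lin_form k L a) = (\<Sum>j<k. const (\<Sum>a\<in>B. L $$ (a, j)) * var j)"
  unfolding lin_form_def by (subst sum.swap) (simp add: const_sum sum_distrib_right)

lemma mpoly2_add_self: "(p::mpoly2) + p = 0"
  by (rule poly_mapping_eqI) (simp only: lookup_add bit_add_self lookup_zero)

lemma single_squarefree:
  assumes "\<And>v. Poly_Mapping.lookup m v \<le> 1"
  shows "Poly_Mapping.single m 1 = (\<Prod>v\<in>Poly_Mapping.keys m. var v)"
proof -
  have prod: "(\<Prod>v\<in>A. var v) = Poly_Mapping.single (\<Sum>v\<in>A. Poly_Mapping.single v 1) 1"
    if "finite A" for A
    using that by (induction A rule: finite_induct) (auto simp: var_def mult_single)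
  have "m = (\<Sum>v\<in>Poly_Mapping.keys m. Poly_Mapping.single v 1)"
  proof (rule poly_mapping_eqI)
    fix w
    have "Poly_Mapping.lookup m w = (if w \<in> Poly_Mapping.keys m then 1 else 0)"
      using assms[of w] by (auto simp: in_keys_iff)
    also have "\<dots> = Poly_Mapping.lookup (\<Sum>v\<in>Poly_Mapping.keys m. Poly_Mapping.single v 1) w"
      by (simp add: lookup_sum lookup_single when_def)
    finally show "Poly_Mapping.lookup m w
      = Poly_Mapping.lookup (\<Sum>v\<in>Poly_Mapping.keys m. Poly_Mapping.single v 1) w" .
  qed
  then show ?thesis using prod[of "Poly_Mapping.keys m"] by simp
qed

lemma char2_ideal_R:
  assumes "ideal J (R k)"
  shows "char2_ideal (carrier (R k)) J"
proof -
  interpret ideal J "R k" by (rule assms)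
  \<comment> \<open>The locale asks for closure under differences, whereas the ideal provides
    closure under sums.\<close>
  have eq: "a - b = a + b" for a b :: mpoly2
    using mpoly2_add_self[of b] by (simp add: diff_eq_eq add.assoc)
  show ?thesis
  proof
    show "a - b \<in> J" if "a \<in> J" "b \<in> J" for a b
      using additive_subgroup.a_closed[OF additive_subgroup_axioms that] by (simp add: eq)
    show "a * b \<in> J" if "a \<in> carrier (R k)" "b \<in> J" for a b
      using I_l_closed[OF that(2,1)] by simp
    show "J \<subseteq> carrier (R k)" using a_subset by simp
    show "0 \<in> J" using additive_subgroup.zero_closed[OF additive_subgroup_axioms] by simp
  qed (auto simp: R_zero_one R_mult eq R_add mpoly2_add_self)
qed

lemma var_square_in_Q: "j < k \<Longrightarrow> var j ^ 2 \<in> Q k"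
proof -
  interpret cring "R k" by (rule cring_R)
  show "j < k \<Longrightarrow> var j ^ 2 \<in> Q k"
    unfolding Q_def using genideal_self[OF gens_in_R(2)] by blast
qed

text \<open>The exponent 2 at \<open>j\<close> splits off as the factor \<open>var j ^ 2\<close>, a
  generator of \<open>Q k\<close>.\<close>

lemma single_in_ideal_of_not_squarefree:
  assumes "ideal J (R k)" "Q k \<subseteq> J" "Poly_Mapping.keys m \<subseteq> {..<k}" "2 \<le> Poly_Mapping.lookup m j"
  shows "Poly_Mapping.single m 1 \<in> J"
proof -
  interpret char2_ideal "carrier (R k)" J by (rule char2_ideal_R[OF assms(1)])
  let ?s = "Poly_Mapping.single j (2::nat)"
  have "j \<in> Poly_Mapping.keys m" using assms(4) by (auto simp: in_keys_iff)
  then have "j < k" using assms(3) by auto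
  have split: "m = (m - ?s) + ?s"
    using assms(4) by (intro poly_mapping_eqI) (auto simp: lookup_add lookup_minus lookup_single when_def)
  have v: "var j ^ 2 = Poly_Mapping.single ?s 1"
    by (simp add: var_def power2_eq_square mult_single single_add[symmetric] numeral_2_eq_2)
  have "Poly_Mapping.keys (m - ?s) \<subseteq> Poly_Mapping.keys m"
    by (auto simp: in_keys_iff lookup_minus)
  then have "Poly_Mapping.single (m - ?s) 1 \<in> carrier (R k)"
    using assms(3) unfolding in_R by auto
  then have "Poly_Mapping.single (m - ?s) 1 * var j ^ 2 \<in> J"
    using var_square_in_Q[OF \<open>j < k\<close>] assms(2) by (intro ideal_mult) auto
  then show ?thesis
    unfolding v mult_single split[symmetric] mult_1_right .
qed

text \<open>A homogeneous polynomial is a sum of monomials, and those that are not squarefree lie in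
  \<open>Q k\<close>. Hence only squarefree monomials remain to be checked.\<close>

lemma dreg_le:
  assumes "ideal J (R k)" "Q k \<subseteq> J"
    and squarefree: "\<And>S. S \<subseteq> {..<k} \<Longrightarrow> card S = d \<Longrightarrow> (\<Prod>v\<in>S. var v) \<in> J"
  shows "dreg k J \<le> d"
proof -
  interpret char2_ideal "carrier (R k)" J by (rule char2_ideal_R[OF assms(1)])
  have mono: "Poly_Mapping.single m 1 \<in> J"
    if m: "Poly_Mapping.keys m \<subseteq> {..<k}" "total_deg m = d" for m
  proof (cases "\<forall>v. Poly_Mapping.lookup m v \<le> 1")
    case True
    then have "Poly_Mapping.lookup m v = 1" if "v \<in> Poly_Mapping.keys m" for v
      using that by (metis in_keys_iff le_neq_implies_less less_one)
    then have "card (Poly_Mapping.keys m) = d"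
      using m(2) by (simp add: total_deg_def)
    then show ?thesis using squarefree[OF m(1)] True by (simp add: single_squarefree)
  next
    case False
    then obtain j where "\<not> Poly_Mapping.lookup m j \<le> 1" by blast
    then have "2 \<le> Poly_Mapping.lookup m j" by linarith
    then show ?thesis by (rule single_in_ideal_of_not_squarefree[OF assms(1,2) m(1)])
  qed
  have "p \<in> J" if p: "p \<in> homog k d" for p
  proof -
    \<comment> \<open>The only nonzero coefficient over F_2 is 1.\<close>
    have "p = (\<Sum>m\<in>Poly_Mapping.keys p. Poly_Mapping.single m 1)"
      by (rule poly_mapping_eqI)
        (auto simp: lookup_sum lookup_single when_def in_keys_iff)
    also have "\<dots> \<in> J"
      using p by (intro ideal_sum mono) (auto simp: homog_def in_R)
    finally show ?thesis .
  qed
  then have "J \<inter> homog k d = homog k d" by blast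
  then show ?thesis unfolding dreg_def by (rule Least_le)
qed

lemma gen_in_J':
  assumes "i < r"
  shows "elem_sym k (2 ^ i) var + elem_sym (n - k) (2 ^ i) (lin_form k L) \<in> J' n r k L"
proof -
  interpret cring "R k" by (rule cring_R)
  interpret Q: ideal "Q k" "R k" unfolding Q_def by (intro genideal_ideal gens_in_R)
  let ?G = "{elem_sym k (2 ^ i) var + elem_sym (n - k) (2 ^ i) (lin_form k L) | i. i < r}"
  have gen: "elem_sym k (2 ^ i) var + elem_sym (n - k) (2 ^ i) (lin_form k L) \<in> Idl\<^bsub>R k\<^esub> ?G"
    using genideal_self[OF gens_in_R(1)[of k n L r]] assms by blast
  have zero: "0 \<in> Q k" using Q.zero_closed by simp
  show ?thesis
    unfolding J'_def set_add_def' by (rule UN_I[OF gen], rule UN_I[OF zero]) simp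
qed

lemma lin_form_in_R: "lin_form k L i \<in> carrier (R k)"
  unfolding lin_form_def by (auto intro!: R_sum R_mult R_var R_const)

text \<open>Squaring is additive in characteristic two, so squares of linear forms inherit
  membership from the squares of the variables.\<close>

lemma (in char2_ideal) sum_square_in_ideal:
  assumes "\<And>a. a \<in> A \<Longrightarrow> f a ^ 2 \<in> I"
  shows "(\<Sum>a\<in>A. f a) ^ 2 \<in> I"
  using assms
proof (induction A rule: infinite_finite_induct)
  case (insert a A)
  have "(f a + sum f A) ^ 2 = f a ^ 2 + sum f A ^ 2 + (f a * sum f A + f a * sum f A)"
    by (simp add: power2_eq_square algebra_simps)
  also have "f a * sum f A + f a * sum f A = 0"
    using diff_eq_add[of "f a * sum f A" "f a * sum f A"] by simp
  finally show ?case using insert by (simp add: ideal_add)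
qed (auto simp: ideal_zero)

text \<open>A generator is a sum, which equals the difference required by \<open>powers\<close>. For
  \<open>above_rank\<close> each summand of e_j lies in the ideal separately, since its forms have a
  nonempty subset with sum 0.\<close>

lemma esym_relations_J':
  assumes L: "L \<in> carrier_mat (n - k) k"
  shows "esym_relations (carrier (R k)) (J' n r k L) {..<k} var {..<n - k} (lin_form k L) r
    (vec_space.rank (n - k) L)"
proof -
  let ?\<rho> = "vec_space.rank (n - k) L"
  interpret char2_ideal "carrier (R k)" "J' n r k L" by (rule char2_ideal_R[OF ideal_J'])
  have var_sq: "var j ^ 2 \<in> J' n r k L" if "j < k" for j
    using var_square_in_Q[OF that] Q_subset_J' by blast
  have form_sq: "lin_form k L i ^ 2 \<in> J' n r k L" for i
    unfolding lin_form_def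
  proof (rule sum_square_in_ideal)
    fix j assume "j \<in> {..<k}"
    moreover have "const (L $$ (i, j)) ^ 2 \<in> carrier (R k)"
      by (simp add: power2_eq_square R_mult R_const)
    ultimately show "(const (L $$ (i, j)) * var j) ^ 2 \<in> J' n r k L"
      using var_sq by (auto simp: power_mult_distrib intro!: ideal_mult)
  qed
  show ?thesis
  proof
    fix i assume "i < r"
    have coeffs: "coeff (esym_poly {..<k} var) (2 ^ i) \<in> carrier (R k)"
      "coeff (esym_poly {..<n - k} (lin_form k L)) (2 ^ i) \<in> carrier (R k)"
      by (auto intro!: coeff_esym_poly_in R_var lin_form_in_R)
    then show "char2_ideal.cong (carrier (R k)) (J' n r k L)
        (coeff (esym_poly {..<k} var) (2 ^ i)) (coeff (esym_poly {..<n - k} (lin_form k L)) (2 ^ i))"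
      using gen_in_J'[OF \<open>i < r\<close>, of k n L] by (simp add: cong_def diff_eq_add elem_sym_eq_coeff)
  next
    fix j assume j: "?\<rho> < j"
    show "coeff (esym_poly {..<n - k} (lin_form k L)) j \<in> J' n r k L"
      unfolding coeff_esym_poly[OF finite_lessThan]
    proof (rule ideal_sum)
      fix A assume "A \<in> {A. A \<subseteq> {..<n - k} \<and> card A = j}"
      then have A: "A \<subseteq> {..<n - k}" "?\<rho> < card A" using j by auto
      obtain B where B: "B \<subseteq> A" "B \<noteq> {}" "\<And>j. j < k \<Longrightarrow> (\<Sum>a\<in>B. L $$ (a, j)) = 0"
        using dependent_rows[OF L A] by blast
      have "(\<Sum>a\<in>B. lin_form k L a) = 0"
        unfolding sum_lin_form by (simp add: B(3) const_0)
      then show "(\<Prod>a\<in>A. lin_form k L a) \<in> J' n r k L"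
        using A(1) B(1,2) finite_subset form_sq lin_form_in_R
        by (intro prod_in_ideal_of_dependent[of A B]) auto
    qed
  qed (auto simp: R_var var_sq form_sq lin_form_in_R)
qed

section \<open>The degree bound by cases\<close>

theorem theorem2p12:
  fixes n r k :: nat and L :: "bit mat"
  assumes "n \<ge> 4"
    and "int r = \<lfloor>log 2 (real n)\<rfloor>"
    and "k \<in> {1..n}"
    and "L \<in> carrier_mat (n - k) k"
  shows "if n = 2 ^ (r + 1) - 1 \<and> k \<ge> 2 ^ r \<and> vec_space.rank (n - k) L = n - k
    then dreg k (J' n r k L) \<le> (k + vec_space.rank (n - k) L) div 2 + 2
       \<and> (k + vec_space.rank (n - k) L) div 2 + 2 = 2 ^ r + 1
    else dreg k (J' n r k L) \<le> (k + vec_space.rank (n - k) L) div 2 + 1"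
proof -
  define \<rho> where "\<rho> = vec_space.rank (n - k) L"
  interpret esym_relations "carrier (R k)" "J' n r k L" "{..<k}" var "{..<n - k}" "lin_form k L" r \<rho>
    unfolding \<rho>_def by (rule esym_relations_J'[OF assms(4)])
  note dreg = dreg_le[OF ideal_J' Q_subset_J']
  have "\<lfloor>log 2 (real n)\<rfloor> = int r" using assms(2) by simp
  then have n_less: "n < 2 * 2 ^ r"
    using floor_log_nat_eq_powr_iff[of 2 n r] assms(1) by (simp add: powr_realpow)
  have "\<rho> \<le> n - k" unfolding \<rho>_def by (rule vec_space.rank_le_nr[OF assms(4)])
  then have k\<rho>: "k + \<rho> \<le> n" using assms(3) by auto
  show ?thesis
  proof (cases "n = 2 ^ (r + 1) - 1 \<and> k \<ge> 2 ^ r \<and> \<rho> = n - k")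
    case True
    then have sum: "k + \<rho> + 1 = 2 * 2 ^ r" using assms(3) by auto
    \<comment> \<open>Here \<open>k + \<rho>\<close> is odd, so halving rounds down to 2^r -
      1.\<close>
    then have d: "(k + \<rho>) div 2 + 2 = 2 ^ r + 1" by linarith
    have "dreg k (J' n r k L) \<le> 2 ^ r + 1"
      by (intro dreg prod_in_ideal_of_Suc) (use sum in auto)
    then show ?thesis
      unfolding \<rho>_def[symmetric] if_P[OF True] d by blast
  next
    case False
    \<comment> \<open>The least d with \<open>k + \<rho> < 2 * d\<close>, the inequality needed to
      make the expansion vanish.\<close>
    define d where "d = (k + \<rho>) div 2 + 1"
    have d: "k + \<rho> < 2 * d" "2 * d \<le> k + \<rho> + 2" by (simp_all add: d_def)
    have "(\<Prod>v\<in>S. var v) \<in> J' n r k L" if S: "S \<subseteq> {..<k}" "card S = d" for S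
    proof (cases "d < 2 ^ r")
      case True
      then show ?thesis using S d by (intro prod_in_ideal_of_lt) auto
    next
      case d_ge: False
      have "d \<le> k" using S card_mono[OF _ S(1)] by simp
      \<comment> \<open>Equality would force n = k + \<rho> = 2^(r+1) - 1, hence \<rho> = n - k;
        with k >= d >= 2^r this is the excluded case.\<close>
      then have "k + \<rho> \<noteq> 2 * 2 ^ r - 1" using False d_ge n_less k\<rho> by auto
      \<comment> \<open>From d >= 2^r follows k + \<rho> >= 2^(r+1) - 2, and k + \<rho> <= n <
        2^(r+1) then leaves one value.\<close>
      then have "k + \<rho> + 2 = 2 * 2 ^ r" "d = 2 ^ r" using d d_ge n_less k\<rho> by linarith+
      then show ?thesis using S by (intro prod_in_ideal_of_eq) auto
    qed
    then have "dreg k (J' n r k L) \<le> d" by (rule dreg)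
    then show ?thesis
      unfolding \<rho>_def[symmetric] if_not_P[OF False] d_def .
  qed
qed

end
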